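(* Let $a_0,a_1,a_2,b_0$ be real numbers with $0>b_0>-a_0$, $0>a_1$ and $a_2>\dfrac{a_1^2}{2|b_0|}$, and let $\bar\tau\ge 0$. Then for all sufficiently small real $b_1,b_2$ (that is, there is $\delta>0$, depending on $a_0,a_1,a_2,b_0,\bar\tau$, such that for all real $b_1,b_2$ with $|b_1|,|b_2|<\delta$) the following holds. Let $W(\lambda)=\lambda^3+a_2\lambda^2+a_1\lambda+a_0+(b_2\lambda^2+b_1\lambda+b_0)e^{-\lambda\tau}$. Suppose that for the delay value $\tau=\bar\tau$ there exists $\bar\omega>0$ such that $W_r(\bar\omega)<0$ and $W_i(\omega)>0$ for all $\omega\in(0,\bar\omega)$. Then stability gain occurs for the delayed system with characteristic function $W$ as the delay $\tau$ increases from $0$, with a minimal threshold $\tau_{10}$ satisfying $\tau_{10}\le\sqrt{\dfrac{2a_2}{|b_0|}}$.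
   Context: Setting: the linear delayed system $x'(t)=-a_0z(t)-b_0z(t-\tau)+A_1$, $y'(t)=-x(t)+a_1z(t)+b_1z(t-\tau)+A_2$, $z'(t)=-y(t)-a_2z(t)-b_2z(t-\tau)+A_3$, with real coefficients $a_j,b_j$, real constants $A_1,A_2,A_3$ and delay $\tau\ge0$. Its characteristic function is $W(\lambda)=\lambda^3+a_2\lambda^2+a_1\lambda+a_0+(b_2\lambda^2+b_1\lambda+b_0)e^{-\lambda\tau}$, $\lambda\in\mathbb{C}$. For real $\omega$, $W_r(\omega)=\operatorname{Re}W(i\omega)$ and $W_i(\omega)=\operatorname{Im}W(i\omega)$ (both depend on $\tau$). For a given $\tau$, the steady state is called stable if all complex zeros of $W$ have negative real part, and unstable if $W$ has a zero with positive real part. "Stability gain occurs with minimal threshold $\tau_{10}$" means: the steady state is unstable for $\tau=0$, and there is $\tau_{10}>0$ such that the steady state is not stable for any $\tau\in[0,\tau_{10})$, while for some $\varepsilon>0$ it is stable for all $\tau\in(\tau_{10},\tau_{10}+\varepsilon)$. *)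

theory Defs
  imports "HOL-Complex_Analysis.Complex_Analysis"
begin

definition char_fun ::
  "real \<Rightarrow> real \<Rightarrow> real \<Rightarrow> real \<Rightarrow> real \<Rightarrow> real \<Rightarrow> real \<Rightarrow> complex \<Rightarrow> complex" where
  "char_fun a0 a1 a2 b0 b1 b2 \<tau> z =
     z ^ 3 + of_real a2 * z ^ 2 + of_real a1 * z + of_real a0
     + (of_real b2 * z ^ 2 + of_real b1 * z + of_real b0) * exp (- (z * of_real \<tau>))"

definition re_on_imag_axis :: "(complex \<Rightarrow> complex) \<Rightarrow> real \<Rightarrow> real" where
  "re_on_imag_axis W \<omega> = Re (W (\<i> * of_real \<omega>))"

definition im_on_imag_axis :: "(complex \<Rightarrow> complex) \<Rightarrow> real \<Rightarrow> real" where
  "im_on_imag_axis W \<omega> = Im (W (\<i> * of_real \<omega>))"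

(* Stability of the steady state is by convention a property of the zeros of the
   characteristic function W at the given delay. A zero on the imaginary axis, with none
   to its right, makes the steady state neither stable nor unstable. *)

definition stable :: "(complex \<Rightarrow> complex) \<Rightarrow> bool" where
  "stable W \<longleftrightarrow> (\<forall>z. W z = 0 \<longrightarrow> Re z < 0)"

definition unstable :: "(complex \<Rightarrow> complex) \<Rightarrow> bool" where
  "unstable W \<longleftrightarrow> (\<exists>z. W z = 0 \<and> Re z > 0)"

(* Here W is a family of characteristic functions indexed by the delay. *)

definition stability_gain :: "(real \<Rightarrow> complex \<Rightarrow> complex) \<Rightarrow> real \<Rightarrow> bool" where
  "stability_gain W \<tau>10 \<longleftrightarrow>
     unstable (W 0) \<and> \<tau>10 > 0 \<and>
     (\<forall>\<tau>\<in>{0..<\<tau>10}. \<not> stable (W \<tau>)) \<and>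
     (\<exists>\<epsilon>>0. \<forall>\<tau>\<in>{\<tau>10<..<\<tau>10 + \<epsilon>}. stable (W \<tau>))"

end

(* For a family of characteristic functions over a compact connected parameter set without zeros on
   the imaginary axis, stability is constant: the zeros in the closed right half-plane are bounded,
   so instability up to the boundary is a closed condition, and by Hurwitz's theorem so is the
   absence of zeros in the open half-plane. This replaces the argument principle: it gives a
   stability criterion (homotopy to a cubic) and, as only finitely many delays in a bounded interval
   admit imaginary zeros, stability gain at the infimum of the stabilising delays.

   Write T for the square root of 2 a2 / |b0|. It remains to find a stable delay in [0, T]. For
   b1 = b2 = 0 the real part W_r is decreasing on (0, oo) for delays up to T. If taubar <= T, then
   after a small perturbation W_r still stays negative once it is negative, so taubar itself is
   stable. If taubar > T, the hypothesis survives in weak form at b1 = b2 = 0 by compactness; it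
   transfers to the delay T by means of x^2 cos x <= (sin x)^2, and stability is an open condition
   in (b1, b2). *)

theory Submission
  imports Defs
begin

section \<open>The characteristic function on the imaginary axis and in the closed right
  half-plane\<close>

lemma re_char_fun:
  "re_on_imag_axis (char_fun a0 a1 a2 b0 b1 b2 \<tau>) \<omega> =
     a0 - a2 * \<omega>\<^sup>2 + (b0 - b2 * \<omega>\<^sup>2) * cos (\<omega> * \<tau>) + b1 * \<omega> * sin (\<omega> * \<tau>)"
  and im_char_fun:
  "im_on_imag_axis (char_fun a0 a1 a2 b0 b1 b2 \<tau>) \<omega> =
     a1 * \<omega> - \<omega> ^ 3 - (b0 - b2 * \<omega>\<^sup>2) * sin (\<omega> * \<tau>) + b1 * \<omega> * cos (\<omega> * \<tau>)"
proof -
  have e: "exp (- (\<i> * of_real \<omega> * of_real \<tau>)) = Complex (cos (\<omega> * \<tau>)) (- sin (\<omega> * \<tau>))"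
    by (simp add: complex_eq_iff Re_exp Im_exp)
  have q: "\<i> * of_real \<omega> = Complex 0 \<omega>"
    by (simp add: complex_eq_iff)
  show "re_on_imag_axis (char_fun a0 a1 a2 b0 b1 b2 \<tau>) \<omega> =
     a0 - a2 * \<omega>\<^sup>2 + (b0 - b2 * \<omega>\<^sup>2) * cos (\<omega> * \<tau>) + b1 * \<omega> * sin (\<omega> * \<tau>)"
    and "im_on_imag_axis (char_fun a0 a1 a2 b0 b1 b2 \<tau>) \<omega> =
     a1 * \<omega> - \<omega> ^ 3 - (b0 - b2 * \<omega>\<^sup>2) * sin (\<omega> * \<tau>) + b1 * \<omega> * cos (\<omega> * \<tau>)"
    unfolding re_on_imag_axis_def im_on_imag_axis_def char_fun_def e
    by (simp_all add: q power2_eq_square power3_eq_cube algebra_simps)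
qed

lemma char_fun_imag_axis_eq_0_iff:
  "char_fun a0 a1 a2 b0 b1 b2 \<tau> (\<i> * of_real \<omega>) = 0 \<longleftrightarrow>
     re_on_imag_axis (char_fun a0 a1 a2 b0 b1 b2 \<tau>) \<omega> = 0 \<and>
     im_on_imag_axis (char_fun a0 a1 a2 b0 b1 b2 \<tau>) \<omega> = 0"
  by (simp add: re_on_imag_axis_def im_on_imag_axis_def complex_eq_iff)

text \<open>For a nonnegative delay the exponential has modulus at most 1 in the closed right
  half-plane, so beyond this radius the cubic term dominates all others. The radius does not depend
  on the delay.\<close>

lemma norm_char_fun_zero_le:
  assumes "char_fun a0 a1 a2 b0 b1 b2 \<tau> z = 0" "Re z \<ge> 0" "\<tau> \<ge> 0"
  shows "norm z \<le> 1 + \<bar>a0\<bar> + \<bar>a1\<bar> + \<bar>a2\<bar> + \<bar>b0\<bar> + \<bar>b1\<bar> + \<bar>b2\<bar>"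
proof (rule ccontr)
  assume "\<not> ?thesis"
  then have big: "norm z > 1 + \<bar>a0\<bar> + \<bar>a1\<bar> + \<bar>a2\<bar> + \<bar>b0\<bar> + \<bar>b1\<bar> + \<bar>b2\<bar>" by simp
  define r where "r = norm z"
  have r1: "r > 1" using big by (simp add: r_def)
  have r2: "r \<le> r\<^sup>2" "1 \<le> r\<^sup>2" using r1 by (simp_all add: power2_eq_square) (smt (verit) mult_le_cancel_left1)
  let ?e = "exp (- (z * of_real \<tau>))"
  have e: "norm ?e \<le> 1"
    using assms by simp
  have "z ^ 3 = - (of_real a2 * z ^ 2 + of_real a1 * z + of_real a0
     + (of_real b2 * z ^ 2 + of_real b1 * z + of_real b0) * ?e)"
    using assms(1) unfolding char_fun_def by (simp add: add_eq_0_iff add.assoc)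
  then have "r ^ 3 = norm (of_real a2 * z ^ 2 + of_real a1 * z + of_real a0
     + (of_real b2 * z ^ 2 + of_real b1 * z + of_real b0) * ?e)"
    unfolding r_def by (metis norm_minus_cancel norm_power)
  also have "\<dots> \<le> norm (of_real a2 * z ^ 2) + norm (of_real a1 * z) + norm (of_real a0 :: complex)
     + norm ((of_real b2 * z ^ 2 + of_real b1 * z + of_real b0) * ?e)"
    by (meson add_mono norm_triangle_le order_refl norm_triangle_ineq)
  also have "norm ((of_real b2 * z ^ 2 + of_real b1 * z + of_real b0) * ?e)
     \<le> norm (of_real b2 * z ^ 2 + of_real b1 * z + of_real b0)"
    using e unfolding norm_mult by (simp add: mult_left_le)
  also have "\<dots> \<le> norm (of_real b2 * z ^ 2) + norm (of_real b1 * z) + norm (of_real b0 :: complex)"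
    by (meson add_mono norm_triangle_le order_refl norm_triangle_ineq)
  finally have "r ^ 3 \<le> \<bar>a2\<bar> * r\<^sup>2 + \<bar>a1\<bar> * r + \<bar>a0\<bar> + (\<bar>b2\<bar> * r\<^sup>2 + \<bar>b1\<bar> * r + \<bar>b0\<bar>)"
    by (simp add: norm_mult norm_power r_def)
  also have "\<dots> \<le> \<bar>a2\<bar> * r\<^sup>2 + \<bar>a1\<bar> * r\<^sup>2 + \<bar>a0\<bar> * r\<^sup>2 + (\<bar>b2\<bar> * r\<^sup>2 + \<bar>b1\<bar> * r\<^sup>2 + \<bar>b0\<bar> * r\<^sup>2)"
    using r2 by (intro add_mono mult_left_mono order_refl) (auto simp: mult_le_cancel_left1)
  also have "\<dots> = (\<bar>a0\<bar> + \<bar>a1\<bar> + \<bar>a2\<bar> + \<bar>b0\<bar> + \<bar>b1\<bar> + \<bar>b2\<bar>) * r\<^sup>2"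
    by (simp add: algebra_simps)
  also have "\<dots> < r * r\<^sup>2"
    using big r2 by (intro mult_strict_right_mono) (auto simp: r_def)
  finally show False by (simp add: power3_eq_cube power2_eq_square)
qed

lemma not_stable_iff: "\<not> stable W \<longleftrightarrow> (\<exists>z. W z = 0 \<and> Re z \<ge> 0)"
  by (auto simp: stable_def not_less)

section \<open>Persistence of stability in compact families\<close>

text \<open>The coefficients and the delay may all vary with the parameter. One locale thus covers
  the homotopy to a cubic, the variation of the delay over an interval, and the perturbation of
  \<open>b1\<close> and \<open>b2\<close> over a square.\<close>

locale char_family =
  fixes A :: "'p::metric_space set" and a0 a1 a2 b0 b1 b2 \<tau> :: "'p \<Rightarrow> real"
  assumes compact: "compact A"
    and cont: "continuous_on A a0" "continuous_on A a1" "continuous_on A a2"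
      "continuous_on A b0" "continuous_on A b1" "continuous_on A b2" "continuous_on A \<tau>"
    and delay: "\<And>p. p \<in> A \<Longrightarrow> \<tau> p \<ge> 0"
begin

abbreviation F :: "'p \<Rightarrow> complex \<Rightarrow> complex" where
  "F p \<equiv> char_fun (a0 p) (a1 p) (a2 p) (b0 p) (b1 p) (b2 p) (\<tau> p)"

lemma continuous_F: "continuous_on (A \<times> K) (\<lambda>(p, z). F p z)"
proof -
  have c: "continuous_on (A \<times> K) (\<lambda>x. f (fst x))" if "continuous_on A f" for f :: "'p \<Rightarrow> real"
    by (rule continuous_on_compose2[OF that continuous_on_fst[OF continuous_on_id]]) auto
  show ?thesis
    unfolding char_fun_def case_prod_unfold
    by (intro continuous_intros cont[THEN c])
qed

lemma zeros_bounded: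
  obtains B where "\<And>p z. p \<in> A \<Longrightarrow> F p z = 0 \<Longrightarrow> Re z \<ge> 0 \<Longrightarrow> norm z \<le> B"
proof -
  let ?g = "\<lambda>p. 1 + \<bar>a0 p\<bar> + \<bar>a1 p\<bar> + \<bar>a2 p\<bar> + \<bar>b0 p\<bar> + \<bar>b1 p\<bar> + \<bar>b2 p\<bar>"
  have "continuous_on A ?g"
    by (intro continuous_intros cont)
  then have "bounded (?g ` A)"
    using compact compact_continuous_image compact_imp_bounded by blast
  then obtain B where B: "\<And>p. p \<in> A \<Longrightarrow> norm (?g p) \<le> B"
    unfolding bounded_iff by blast
  have "norm z \<le> B" if "p \<in> A" "F p z = 0" "Re z \<ge> 0" for p z
    using norm_char_fun_zero_le[OF that(2,3) delay[OF that(1)]] B[OF that(1)]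
    by (simp only: real_norm_def) linarith
  then show ?thesis using that by blast
qed

text \<open>Zeros in the closed right half-plane lie in a compact half-disc \<open>K\<close>, so
  this set is the projection to \<open>A\<close> of a compact set of pairs of a parameter and a
  zero.\<close>

lemma closed_not_stable: "closed {p \<in> A. \<not> stable (F p)}"
proof -
  obtain B where B: "\<And>p z. p \<in> A \<Longrightarrow> F p z = 0 \<Longrightarrow> Re z \<ge> 0 \<Longrightarrow> norm z \<le> B"
    using zeros_bounded by blast
  define K where "K = cball 0 B \<inter> {z::complex. Re z \<ge> 0}"
  have K: "compact K"
    unfolding K_def by (intro compact_Int_closed compact_cball closed_halfspace_Re_ge)
  let ?Z = "{x \<in> A \<times> K. (case x of (p, z) \<Rightarrow> F p z) = 0}"
  have "closedin (top_of_set (A \<times> K)) ?Z"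
    using continuous_closedin_preimage_constant[OF continuous_F] by blast
  then have "compact ?Z"
    by (rule closedin_compact[OF compact_Times[OF compact K]])
  then have "compact (fst ` ?Z)"
    by (rule compact_continuous_image[rotated]) (intro continuous_intros)
  moreover have "fst ` ?Z = {p \<in> A. \<not> stable (F p)}"
  proof (intro set_eqI iffI)
    fix p assume "p \<in> fst ` ?Z"
    then obtain z where "p \<in> A" "Re z \<ge> 0" "F p z = 0"
      by (auto simp: K_def)
    then show "p \<in> {p \<in> A. \<not> stable (F p)}"
      unfolding not_stable_iff by blast
  next
    fix p assume "p \<in> {p \<in> A. \<not> stable (F p)}"
    then obtain z where z: "p \<in> A" "Re z \<ge> 0" "F p z = 0"
      unfolding not_stable_iff by blast
    then have "z \<in> K"
      using B[OF z(1,3,2)] by (simp add: K_def)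
    with z have "(p, z) \<in> ?Z" by simp
    then show "p \<in> fst ` ?Z" by (rule rev_image_eqI) simp
  qed
  ultimately show ?thesis
    by (simp only: compact_imp_closed)
qed

text \<open>Convergent parameters give locally uniformly convergent functions. By Hurwitz's theorem
  a nonconstant limit of functions without zeros in the open right half-plane has none there
  either.\<close>

lemma closed_not_unstable: "closed {p \<in> A. \<not> unstable (F p)}"
proof (unfold closed_sequential_limits, intro allI impI, elim conjE)
  fix P l assume P: "\<forall>n. P n \<in> {p \<in> A. \<not> unstable (F p)}" and lim: "P \<longlonglongrightarrow> l"
  have PA: "P n \<in> A" and Pu: "\<And>z. Re z > 0 \<Longrightarrow> F (P n) z \<noteq> 0" for n
    using P by (auto simp: unstable_def)
  have lA: "l \<in> A"
    using compact PA lim compact_imp_closed closed_sequentially by metis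
  obtain B where B: "\<And>p z. p \<in> A \<Longrightarrow> F p z = 0 \<Longrightarrow> Re z \<ge> 0 \<Longrightarrow> norm z \<le> B"
    using zeros_bounded by blast
  let ?S = "{z::complex. Re z > 0}"
  have "F l z \<noteq> 0" if z: "Re z > 0" for z
  \<comment> \<open>Hurwitz's theorem asks for a nonconstant limit. In the constant case the value
    at a point beyond the zero bound \<open>B\<close> is nonzero.\<close>
  proof (cases "F l constant_on ?S")
    case True
    have "F l (of_real (1 + \<bar>B\<bar>)) \<noteq> 0"
      using B[OF lA, of "of_real (1 + \<bar>B\<bar>)"] by (auto simp del: of_real_add)
    moreover obtain c where "\<forall>w\<in>?S. F l w = c"
      using True unfolding constant_on_def by (elim exE)
    moreover have "of_real (1 + \<bar>B\<bar>) \<in> ?S" "z \<in> ?S"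
      using z by simp_all
    ultimately show ?thesis by metis
  next
    case False
    show ?thesis
    proof (rule Hurwitz_no_zeros[of ?S "\<lambda>n. F (P n)" "F l"])
      show "open ?S" by (rule open_halfspace_Re_gt)
      show "connected ?S" by (intro convex_connected convex_halfspace_Re_gt)
      show "F (P n) holomorphic_on ?S" for n
        unfolding char_fun_def by (intro holomorphic_intros)
      show "F l holomorphic_on ?S"
        unfolding char_fun_def by (intro holomorphic_intros)
      show "uniform_limit K (\<lambda>n. F (P n)) (F l) sequentially" if K: "compact K" "K \<subseteq> ?S" for K
      proof (rule uniform_limitI)
        fix e :: real assume "e > 0"
        let ?f = "\<lambda>(p, z). F p z"
        \<comment> \<open>Joint uniform continuity on the compact product turns convergence of the
          parameters into convergence uniform in \<open>z\<close>.\<close>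
        have "uniformly_continuous_on (A \<times> K) ?f"
          by (intro compact_uniformly_continuous continuous_F compact_Times compact K)
        then have "\<exists>d>0. \<forall>x\<in>A \<times> K. \<forall>y\<in>A \<times> K. dist y x < d \<longrightarrow> dist (?f y) (?f x) < e"
          using \<open>e > 0\<close> unfolding uniformly_continuous_on_def by (elim allE impE) assumption+
        then obtain d where d: "d > 0"
          "\<forall>x\<in>A \<times> K. \<forall>y\<in>A \<times> K. dist y x < d \<longrightarrow> dist (?f y) (?f x) < e"
          by (elim exE conjE)
        have "eventually (\<lambda>n. dist (P n) l < d) sequentially"
          using lim d(1) by (simp add: tendsto_iff)
        then show "eventually (\<lambda>n. \<forall>z\<in>K. dist (F (P n) z) (F l z) < e) sequentially"
        proof eventually_elim
          case (elim n)
          show ?case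
          proof
            fix z assume "z \<in> K"
            then show "dist (F (P n) z) (F l z) < e"
              using d(2)[rule_format, of "(l, z)" "(P n, z)"] PA lA elim by (simp add: dist_Pair_Pair)
          qed
        qed
      qed
      show "\<not> F l constant_on ?S" by fact
      show "F (P n) w \<noteq> 0" if "w \<in> ?S" for n w using Pu that by simp
      show "z \<in> ?S" using z by simp
    qed
  qed
  with lA show "l \<in> {p \<in> A. \<not> unstable (F p)}" by (auto simp: unstable_def)
qed

text \<open>With no zeros on the imaginary axis, being not stable is the same as being unstable. The
  two closed sets above then cover \<open>A\<close> disjointly, so a connected \<open>A\<close> lies
  in one of them.\<close>

lemma stable_constant:
  assumes conn: "connected A" and "p \<in> A" "q \<in> A" "stable (F p)"
    and no: "\<And>p \<omega>. p \<in> A \<Longrightarrow> F p (\<i> * of_real \<omega>) \<noteq> 0"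
  shows "stable (F q)"
proof (rule ccontr)
  assume nq: "\<not> stable (F q)"
  have *: "unstable (F r)" if nr: "\<not> stable (F r)" "r \<in> A" for r
  proof -
    obtain z where z: "F r z = 0" "Re z \<ge> 0"
      using nr(1) unfolding not_stable_iff by blast
    have "Re z \<noteq> 0"
    proof
      assume "Re z = 0"
      then have "z = \<i> * of_real (Im z)" by (simp add: complex_eq_iff)
      with no[OF nr(2), of "Im z"] z show False by simp
    qed
    with z show ?thesis by (auto simp: unstable_def intro!: exI[of _ z])
  qed
  have **: "\<not> unstable (F r)" if "stable (F r)" for r
    using that by (force simp: stable_def unstable_def)
  let ?N = "{p \<in> A. \<not> stable (F p)}" and ?U = "{p \<in> A. \<not> unstable (F p)}"
  have "?N \<inter> ?U \<inter> A = {}" "A \<subseteq> ?N \<union> ?U" "?N \<inter> A \<noteq> {}" "?U \<inter> A \<noteq> {}"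
    using * ** nq assms(2-4) by auto
  then show False
    using conn closed_not_stable closed_not_unstable unfolding connected_closed by blast
qed

end

section \<open>A stability criterion on the imaginary axis\<close>

text \<open>At each frequency the comparison cubic shares a strict sign with the given function,
  either in the real or in the imaginary part, so no convex combination of the two vanishes there.
  The real and the imaginary part of the cubic change sign at \<open>k\<close> and
  \<open>3 * k\<close>, respectively.\<close>

lemma stable_char_fun_criterion:
  assumes "\<tau> \<ge> 0" "k > 0"
    and crit: "\<And>\<omega>. \<omega> \<ge> 0 \<Longrightarrow>
      re_on_imag_axis (char_fun a0 a1 a2 b0 b1 b2 \<tau>) \<omega> > 0 \<and> \<omega> < k \<or>
      im_on_imag_axis (char_fun a0 a1 a2 b0 b1 b2 \<tau>) \<omega> > 0 \<and> 0 < \<omega> \<and> \<omega> < 3 * k \<or>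
      re_on_imag_axis (char_fun a0 a1 a2 b0 b1 b2 \<tau>) \<omega> < 0 \<and> \<omega> > k"
  shows "stable (char_fun a0 a1 a2 b0 b1 b2 \<tau>)"
proof -
  define m where "m = sqrt 3 * k"
  have m: "m > 0" "m\<^sup>2 = 3 * k\<^sup>2"
    using assms(2) by (simp_all add: m_def power_mult_distrib)
  \<comment> \<open>The linear homotopy to the stable polynomial \<open>(z + m) ^ 3\<close>, whose value at \<open>\<i> \<omega>\<close>
    has real part \<open>3 m (k\<^sup>2 - \<omega>\<^sup>2)\<close> and imaginary part \<open>\<omega> (9 k\<^sup>2 - \<omega>\<^sup>2)\<close>.\<close>
  interpret char_family "{0..1::real}"
    "\<lambda>s. (1 - s) * a0 + s * m ^ 3" "\<lambda>s. (1 - s) * a1 + s * (3 * m\<^sup>2)" "\<lambda>s. (1 - s) * a2 + s * (3 * m)"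
    "\<lambda>s. (1 - s) * b0" "\<lambda>s. (1 - s) * b1" "\<lambda>s. (1 - s) * b2" "\<lambda>_. \<tau>"
    using assms by unfold_locales (auto intro!: continuous_intros)
  let ?R = "re_on_imag_axis (char_fun a0 a1 a2 b0 b1 b2 \<tau>)"
    and ?I = "im_on_imag_axis (char_fun a0 a1 a2 b0 b1 b2 \<tau>)"
  have re: "re_on_imag_axis (F s) \<omega> = (1 - s) * ?R \<omega> + s * (3 * m * (k\<^sup>2 - \<omega>\<^sup>2))" for s \<omega>
  proof -
    have "m ^ 3 = m * (3 * k\<^sup>2)"
      using m(2) by (simp add: power3_eq_cube power2_eq_square)
    then show ?thesis
      unfolding re_char_fun by (simp add: algebra_simps)
  qed
  have im: "im_on_imag_axis (F s) \<omega> = (1 - s) * ?I \<omega> + s * (\<omega> * (9 * k\<^sup>2 - \<omega>\<^sup>2))" for s \<omega>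
    unfolding im_char_fun m(2) by (simp add: algebra_simps power3_eq_cube power2_eq_square)
  have combine: "(1 - s) * x + s * y > 0" if "s \<in> {0..1}" "x > 0" "y > 0" for s x y :: real
    using that by (cases "s = 0") (auto intro: add_nonneg_pos)
  have nonneg: "F s (\<i> * of_real \<omega>) \<noteq> 0" if s: "s \<in> {0..1}" and \<omega>: "\<omega> \<ge> 0" for s \<omega>
    using crit[OF \<omega>]
  proof (elim disjE conjE)
    assume *: "?R \<omega> > 0" "\<omega> < k"
    then have "\<omega>\<^sup>2 < k\<^sup>2" using \<omega> by (intro power_strict_mono) auto
    then show ?thesis
      using combine[OF s *(1), of "3 * m * (k\<^sup>2 - \<omega>\<^sup>2)"] m(1)
      by (simp add: char_fun_imag_axis_eq_0_iff re)
  next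
    assume *: "?I \<omega> > 0" "0 < \<omega>" "\<omega> < 3 * k"
    then have "\<omega>\<^sup>2 < (3 * k)\<^sup>2" by (intro power_strict_mono) auto
    then have "\<omega> * (9 * k\<^sup>2 - \<omega>\<^sup>2) > 0"
      using *(2) by (simp add: power_mult_distrib)
    then show ?thesis
      using combine[OF s *(1), of "\<omega> * (9 * k\<^sup>2 - \<omega>\<^sup>2)"]
      by (simp add: char_fun_imag_axis_eq_0_iff im)
  next
    assume *: "?R \<omega> < 0" "\<omega> > k"
    then have "k\<^sup>2 < \<omega>\<^sup>2" using assms(2) by (intro power_strict_mono) auto
    then have "3 * m * (\<omega>\<^sup>2 - k\<^sup>2) > 0" using m(1) by simp
    then have "(1 - s) * - ?R \<omega> + s * (3 * m * (\<omega>\<^sup>2 - k\<^sup>2)) > 0"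
      using *(1) by (intro combine s) simp_all
    then have "re_on_imag_axis (F s) \<omega> < 0"
      unfolding re by (simp add: algebra_simps)
    then show ?thesis
      by (simp add: char_fun_imag_axis_eq_0_iff)
  qed
  \<comment> \<open>The coefficients are real, so zeros come in conjugate pairs and nonnegative
    frequencies suffice.\<close>
  have even: "F s (\<i> * of_real (- \<omega>)) = 0 \<longleftrightarrow> F s (\<i> * of_real \<omega>) = 0" for s \<omega>
    unfolding char_fun_imag_axis_eq_0_iff re_char_fun im_char_fun by auto
  have no: "F s (\<i> * of_real \<omega>) \<noteq> 0" if "s \<in> {0..1}" for s \<omega>
    using nonneg[OF that, of \<omega>] nonneg[OF that, of "- \<omega>"] even[of s \<omega>] by linarith
  have "F 1 z = (z + of_real m) ^ 3" for z
    by (simp add: char_fun_def power3_eq_cube power2_eq_square algebra_simps)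
  then have "stable (F 1)"
    using m(1) by (auto simp: stable_def eq_neg_iff_add_eq_0[symmetric])
  then have "stable (F 0)"
    using stable_constant[of 1 0] no by simp
  then show ?thesis by simp
qed

section \<open>Critical delays and the threshold of stability gain\<close>

text \<open>Comparing moduli of the polynomial and the delayed term eliminates the delay, which
  leaves finitely many frequencies. For a fixed frequency the critical delays are zeros of an entire
  function, and these are isolated because the delay \<open>s\<close> keeps it from vanishing
  identically.\<close>

lemma finite_imag_axis_delays:
  assumes s: "\<And>\<omega>. char_fun a0 a1 a2 b0 b1 b2 s (\<i> * of_real \<omega>) \<noteq> 0"
  shows "finite {\<tau> \<in> {0..M}. \<exists>\<omega>. char_fun a0 a1 a2 b0 b1 b2 \<tau> (\<i> * of_real \<omega>) = 0}"
proof -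
  \<comment> \<open>Its value is the squared modulus of the undelayed polynomial at
    \<open>\<i> * \<omega>\<close> minus that of the coefficient of the exponential. It is monic of
    degree six, hence nonzero.\<close>
  define p where "p = [:a0\<^sup>2 - b0\<^sup>2, 0, a1\<^sup>2 - 2 * a0 * a2 - b1\<^sup>2 + 2 * b0 * b2, 0,
    a2\<^sup>2 - 2 * a1 - b2\<^sup>2, 0, 1:]"
  have root: "poly p \<omega> = 0"
    if "char_fun a0 a1 a2 b0 b1 b2 \<tau> (\<i> * of_real \<omega>) = 0" for \<tau> \<omega>
  proof -
    define c d where "c = cos (\<omega> * \<tau>)" and "d = sin (\<omega> * \<tau>)"
    have "a0 - a2 * \<omega>\<^sup>2 = - ((b0 - b2 * \<omega>\<^sup>2) * c + b1 * \<omega> * d)"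
      and "a1 * \<omega> - \<omega> ^ 3 = (b0 - b2 * \<omega>\<^sup>2) * d - b1 * \<omega> * c"
      using that unfolding char_fun_imag_axis_eq_0_iff re_char_fun im_char_fun c_def d_def
      by linarith+
    then have "(a0 - a2 * \<omega>\<^sup>2)\<^sup>2 + (a1 * \<omega> - \<omega> ^ 3)\<^sup>2 =
        ((b0 - b2 * \<omega>\<^sup>2)\<^sup>2 + (b1 * \<omega>)\<^sup>2) * (c\<^sup>2 + d\<^sup>2)"
      by (simp only:) (simp add: power2_eq_square algebra_simps)
    also have "c\<^sup>2 + d\<^sup>2 = 1"
      by (simp add: c_def d_def)
    finally show ?thesis
      by (simp add: p_def) algebra
  qed
  have "p \<noteq> 0" by (simp add: p_def)
  then have "finite {\<omega>. poly p \<omega> = 0}"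
    by (rule poly_roots_finite)
  moreover have "finite {\<tau> \<in> {0..M}. char_fun a0 a1 a2 b0 b1 b2 \<tau> (\<i> * of_real \<omega>) = 0}" for \<omega>
  proof -
    define P Q where "P = (\<i> * of_real \<omega>) ^ 3 + of_real a2 * (\<i> * of_real \<omega>)\<^sup>2 + of_real a1 * (\<i> * of_real \<omega>) + of_real a0"
      and "Q = of_real b2 * (\<i> * of_real \<omega>)\<^sup>2 + of_real b1 * (\<i> * of_real \<omega>) + of_real b0"
    define h where "h t = P + Q * exp (- (\<i> * of_real \<omega> * t))" for t
    have h: "char_fun a0 a1 a2 b0 b1 b2 \<tau> (\<i> * of_real \<omega>) = h (of_real \<tau>)" for \<tau>
      by (simp add: char_fun_def h_def P_def Q_def)
    show ?thesis
    \<comment> \<open>Here the delay is a complex variable. A constant \<open>h\<close> equals its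
      value at \<open>s\<close>, which is nonzero.\<close>
    proof (cases "h constant_on UNIV")
      case True
      then have "h t = h (of_real s)" for t
        unfolding constant_on_def by (metis UNIV_I)
      then have "h t \<noteq> 0" for t
        using s[of \<omega>] unfolding h by metis
      then show ?thesis by (simp add: h)
    next
      case False
      have "finite {t \<in> of_real ` {0..M}. h t = 0}"
      proof (rule holomorphic_compact_finite_zeros[of h UNIV])
        show "h holomorphic_on UNIV"
          unfolding h_def by (intro holomorphic_intros)
        show "compact (of_real ` {0..M} :: complex set)"
          by (intro compact_continuous_image continuous_intros compact_Icc)
      qed (use False in auto)
      then have "finite (of_real ` {\<tau> \<in> {0..M}. h (of_real \<tau>) = 0} :: complex set)"
        by (rule rev_finite_subset) auto
      then have "finite {\<tau> \<in> {0..M}. h (of_real \<tau>) = 0}"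
        by (rule finite_imageD) (simp add: inj_on_def)
      then show ?thesis by (simp only: h)
    qed
  qed
  ultimately have "finite (\<Union>\<omega>\<in>{\<omega>. poly p \<omega> = 0}.
      {\<tau> \<in> {0..M}. char_fun a0 a1 a2 b0 b1 b2 \<tau> (\<i> * of_real \<omega>) = 0})"
    by simp
  then show ?thesis
    by (rule rev_finite_subset) (use root in blast)
qed

text \<open>The threshold is the infimum \<open>T\<close> of the stable delays. Closedness of the
  two sets of delays excludes \<open>T = 0\<close> and stability at \<open>T\<close>. Just above
  \<open>T\<close> there are no critical delays, so stability spreads from delays in
  \<open>S\<close> near \<open>T\<close>.\<close>

lemma stability_gain_if_stable:
  assumes unst: "unstable (char_fun a0 a1 a2 b0 b1 b2 0)"
    and s: "stable (char_fun a0 a1 a2 b0 b1 b2 s)" "s \<ge> 0"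
  shows "\<exists>\<tau>10\<le>s. stability_gain (char_fun a0 a1 a2 b0 b1 b2) \<tau>10"
proof -
  define W where "W = char_fun a0 a1 a2 b0 b1 b2"
  define S where "S = {\<tau>. \<tau> \<ge> 0 \<and> stable (W \<tau>)}"
  define T where "T = Inf S"
  have sS: "s \<in> S" using s by (simp add: S_def W_def)
  have bdd: "bdd_below S" by (auto simp: S_def)
  have T0: "0 \<le> T"
    unfolding T_def using sS by (intro cInf_greatest) (auto simp: S_def)
  have Tle: "T \<le> \<tau>" if "\<tau> \<in> S" for \<tau>
    unfolding T_def by (rule cInf_lower[OF that bdd])
  have near: "\<exists>\<tau>\<in>S. \<tau> < x" if "x > T" for x
    using that sS bdd unfolding T_def by (metis cInf_less_iff empty_iff)
  have fam: "char_family {x..y} (\<lambda>_. a0) (\<lambda>_. a1) (\<lambda>_. a2) (\<lambda>_. b0) (\<lambda>_. b1) (\<lambda>_. b2) (\<lambda>\<tau>. \<tau>)"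
    if "x \<ge> 0" for x y :: real
    using that by unfold_locales auto
  have not_both: "\<not> (stable (W \<tau>) \<and> unstable (W \<tau>))" for \<tau>
    by (force simp: stable_def unstable_def)
  have Tpos: "T > 0"
  proof (rule ccontr)
    assume "\<not> ?thesis"
    then have [simp]: "T = 0" using T0 by simp
    \<comment> \<open>If \<open>T\<close> were 0, stable delays would accumulate at 0, and the
      closedness of this set would contradict instability at delay 0.\<close>
    let ?C = "{\<tau> \<in> {0..1}. \<not> unstable (W \<tau>)}"
    have C: "closed ?C"
      using char_family.closed_not_unstable[OF fam[of 0 1]] by (simp add: W_def)
    have "0 \<in> closure ?C"
      unfolding closure_approachable
    proof (intro allI impI)
      fix e :: real assume "e > 0"
      then obtain \<tau> where "\<tau> \<in> S" "\<tau> < min e 1"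
        using near[of "min e 1"] by auto
      then show "\<exists>y\<in>?C. dist y 0 < e"
        using not_both by (intro bexI[of _ \<tau>]) (auto simp: S_def)
    qed
    then have "0 \<in> ?C" using C by (simp only: closure_closed)
    then show False using unst by (simp add: W_def)
  qed
  have TS: "T \<notin> S"
  proof
    assume "T \<in> S"
    \<comment> \<open>Delays below \<open>T\<close> are not stable and accumulate at
      \<open>T\<close>, so closedness passes this on to \<open>T\<close>.\<close>
    let ?C = "{\<tau> \<in> {0..T}. \<not> stable (W \<tau>)}"
    have C: "closed ?C"
      using char_family.closed_not_stable[OF fam[of 0 T]] by (simp add: W_def)
    have "T \<in> closure ?C"
      unfolding closure_approachable
    proof (intro allI impI)
      fix e :: real assume "e > 0"
      let ?y = "max (T / 2) (T - e / 2)"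
      have y: "?y \<ge> 0" "?y < T" "dist ?y T < e"
        using \<open>e > 0\<close> Tpos by (auto simp: dist_real_def max_def)
      then have "?y \<notin> S" using Tle by force
      with y show "\<exists>y\<in>?C. dist y T < e"
        by (intro bexI[of _ ?y]) (auto simp: S_def)
    qed
    then have "T \<in> ?C" using C by (simp only: closure_closed)
    then show False using \<open>T \<in> S\<close> by (simp add: S_def)
  qed
  \<comment> \<open>The finiteness of the critical delays needs a bounded interval. The bound
    \<open>T + 1\<close> is matched by the factor 1 in \<open>min d 1\<close> below.\<close>
  let ?Z = "{\<tau> \<in> {0..T + 1}. \<exists>\<omega>. W \<tau> (\<i> * of_real \<omega>) = 0}"
  have "W s (\<i> * of_real \<omega>) \<noteq> 0" for \<omega>
    using sS by (auto simp: S_def stable_def)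
  then have "finite ?Z"
    unfolding W_def by (rule finite_imag_axis_delays)
  from finite_set_avoid[OF this, of T]
  obtain d where d: "d > 0" "\<forall>\<tau>\<in>?Z. \<tau> \<noteq> T \<longrightarrow> d \<le> dist T \<tau>"
    by (elim exE conjE)
  have "stable (W \<tau>)" if \<tau>: "\<tau> \<in> {T<..<T + min d 1}" for \<tau>
  proof -
    \<comment> \<open>By the choice of the infimum some stable delay lies strictly between
      \<open>T\<close> and \<tau>. Stability is carried from it to \<tau> over an interval free of
      critical delays.\<close>
    obtain \<sigma> where \<sigma>: "\<sigma> \<in> S" "\<sigma> < \<tau>" using near \<tau> by auto
    then have "T < \<sigma>" using Tle TS by (metis order_le_less)
    interpret char_family "{\<sigma>..\<tau>}" "\<lambda>_. a0" "\<lambda>_. a1" "\<lambda>_. a2" "\<lambda>_. b0" "\<lambda>_. b1" "\<lambda>_. b2" "\<lambda>\<tau>. \<tau>"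
      using \<sigma> by (intro fam) (simp add: S_def)
    have no: "W \<rho> (\<i> * of_real \<omega>) \<noteq> 0" if "\<rho> \<in> {\<sigma>..\<tau>}" for \<rho> \<omega>
    proof
      assume "W \<rho> (\<i> * of_real \<omega>) = 0"
      then have "\<rho> \<in> ?Z" using that \<open>T < \<sigma>\<close> T0 \<tau> by auto
      then show False
        using d(2)[rule_format, of \<rho>] that \<open>T < \<sigma>\<close> \<tau> by (auto simp: dist_real_def)
    qed
    show ?thesis
      using stable_constant[of \<sigma> \<tau>] no \<sigma> by (auto simp: W_def S_def)
  qed
  then have "\<exists>\<epsilon>>0. \<forall>\<tau>\<in>{T<..<T + \<epsilon>}. stable (W \<tau>)"
    using d(1) by (intro exI[of _ "min d 1"]) auto
  moreover have "\<forall>\<tau>\<in>{0..<T}. \<not> stable (W \<tau>)"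
    using Tle by (force simp: S_def)
  ultimately have "stability_gain W T"
    using unst Tpos by (simp add: stability_gain_def W_def)
  then show ?thesis
    using Tle[OF sS] by (auto simp: W_def)
qed

section \<open>Instability at delay zero\<close>

text \<open>There is a negative real root \<open>r\<close>. In the remaining quadratic factor with
  coefficients \<open>p\<close> and \<open>q\<close>, the sign of \<open>c0\<close> forces
  \<open>q > 0\<close>, and then the sign of \<open>c1\<close> forces \<open>p < 0\<close>, so a
  root of it lies to the right of the imaginary axis.\<close>

lemma real_cubic_root_right_half_plane:
  fixes c0 c1 c2 :: real
  assumes "c0 > 0" "c1 < 0"
  shows "\<exists>z::complex. z ^ 3 + of_real c2 * z\<^sup>2 + of_real c1 * z + of_real c0 = 0 \<and> Re z > 0"
proof -
  \<comment> \<open>A Cauchy-type bound: at \<open>- L\<close> the leading term outweighs the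
    others, while the cubic is positive at 0.\<close>
  define L where "L = 1 + \<bar>c0\<bar> + \<bar>c1\<bar> + \<bar>c2\<bar>"
  let ?f = "\<lambda>x. x ^ 3 + c2 * x\<^sup>2 + c1 * x + c0"
  have "L \<ge> 1" by (simp add: L_def)
  then have L: "L \<ge> 1" "L \<le> L\<^sup>2" "1 \<le> L\<^sup>2"
    by (simp_all add: self_le_power one_le_power)
  have "c2 * L\<^sup>2 \<le> \<bar>c2\<bar> * L\<^sup>2" "- c1 * L \<le> \<bar>c1\<bar> * L" "c0 \<le> \<bar>c0\<bar>"
    using L mult_right_mono[OF abs_ge_minus_self, of L c1] by (simp_all add: mult_right_mono)
  then have "?f (- L) \<le> - (L * L\<^sup>2) + \<bar>c2\<bar> * L\<^sup>2 + \<bar>c1\<bar> * L + \<bar>c0\<bar> * 1"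
    by (simp add: power3_eq_cube power2_eq_square)
  also have "\<dots> \<le> - (L * L\<^sup>2) + \<bar>c2\<bar> * L\<^sup>2 + \<bar>c1\<bar> * L\<^sup>2 + \<bar>c0\<bar> * L\<^sup>2"
    using L by (intro add_mono mult_left_mono order_refl) auto
  also have "\<dots> = - (L\<^sup>2)"
    by (simp add: L_def algebra_simps)
  finally have "?f (- L) \<le> 0" by (meson order_trans neg_le_0_iff_le zero_le_power2)
  moreover have "0 \<le> ?f 0" using assms by simp
  moreover have "- L \<le> 0" using L by simp
  ultimately obtain r where r: "r \<le> 0" "?f r = 0"
    using IVT'[of ?f "- L" 0 0] by (force intro: continuous_intros)
  with assms have "r < 0" by (cases "r = 0") auto
  define p q where "p = c2 + r" and "q = c1 + r * p"
  have q: "- r * q = c0"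
    using r(2) by (simp add: q_def p_def algebra_simps power3_eq_cube power2_eq_square)
  then have "q > 0"
    using assms(1) \<open>r < 0\<close> by (metis neg_0_less_iff_less zero_less_mult_pos)
  then have "r * p > 0" using assms(2) by (simp add: q_def)
  then have "p < 0" using \<open>r < 0\<close> by (simp add: zero_less_mult_iff)
  \<comment> \<open>The principal square root has nonnegative real part, so the real part of this
    root is at least \<open>- p / 2\<close>.\<close>
  define z where "z = (csqrt (of_real (p\<^sup>2 - 4 * q)) - of_real p) / 2"
  have "z\<^sup>2 + of_real p * z + of_real q = 0"
  proof -
    define w where "w = csqrt (of_real (p\<^sup>2 - 4 * q))"
    have w: "w\<^sup>2 = of_real p ^ 2 - 4 * of_real q" by (simp add: w_def)
    have "2 * z = w - of_real p" by (simp add: z_def w_def)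
    with w have "4 * (z\<^sup>2 + of_real p * z + of_real q) = 0" by algebra
    then show ?thesis unfolding mult_eq_0_iff by simp
  qed
  moreover have "z ^ 3 + of_real c2 * z\<^sup>2 + of_real c1 * z + of_real c0 =
      (z - of_real r) * (z\<^sup>2 + of_real p * z + of_real q)"
  proof -
    have c: "c2 = p - r" "c1 = q - r * p" "c0 = - r * q"
      using q by (simp_all add: p_def q_def)
    show ?thesis
      unfolding c by (simp add: algebra_simps power3_eq_cube power2_eq_square)
  qed
  moreover have "Re z > 0"
    using Re_csqrt[of "of_real (p\<^sup>2 - 4 * q)"] \<open>p < 0\<close> unfolding z_def
    by (simp del: of_real_diff of_real_power csqrt.simps)
  ultimately show ?thesis by auto
qed

section \<open>Trigonometric inequalities\<close>

lemma sin_less_self: "sin x < x" if "0 < x" for x :: real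
proof (cases "x \<le> 1")
  case False
  then show ?thesis using sin_le_one[of x] by linarith
next
  case True
  have "(\<lambda>u. u - sin u) 0 < (\<lambda>u. u - sin u) x"
  proof (rule DERIV_pos_imp_increasing_open[OF that])
    fix u assume u: "0 < u" "u < x"
    have "((\<lambda>u. u - sin u) has_real_derivative 1 - cos u) (at u)"
      by (auto intro!: derivative_eq_intros)
    moreover have "cos u < cos 0"
      using u True pi_ge_two by (intro cos_monotone_0_pi) auto
    ultimately show "\<exists>y. ((\<lambda>u. u - sin u) has_real_derivative y) (at u) \<and> 0 < y"
      by auto
  qed (intro continuous_intros)
  then show ?thesis by simp
qed

text \<open>Up to an affine change, this function of \<omega> times the delay is \<open>W_r\<close>
  at the delay \<open>T\<close> and \<open>b1 = b2 = 0\<close>. Its monotonicity makes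
  \<open>W_r\<close> strictly decreasing there.\<close>

lemma half_square_plus_cos_less:
  fixes x y :: real
  assumes "0 \<le> x" "x < y"
  shows "x\<^sup>2 / 2 + cos x < y\<^sup>2 / 2 + cos y"
proof (rule DERIV_pos_imp_increasing_open[OF assms(2)])
  fix u assume u: "x < u" "u < y"
  have "((\<lambda>u. u\<^sup>2 / 2 + cos u) has_real_derivative u - sin u) (at u)"
    by (auto intro!: derivative_eq_intros)
  then show "\<exists>d. ((\<lambda>u. u\<^sup>2 / 2 + cos u) has_real_derivative d) (at u) \<and> 0 < d"
    using sin_less_self[of u] u assms by auto
qed (intro continuous_intros, auto)

lemma mult_cos_le_sin:
  fixes x :: real
  assumes "0 \<le> x" "x \<le> pi"
  shows "x * cos x \<le> sin x"
proof -
  have "(\<lambda>u. sin u - u * cos u) 0 \<le> (\<lambda>u. sin u - u * cos u) x"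
  proof (rule DERIV_nonneg_imp_nondecreasing[OF assms(1)])
    fix u assume u: "0 \<le> u" "u \<le> x"
    have "((\<lambda>u. sin u - u * cos u) has_real_derivative u * sin u) (at u)"
      by (auto intro!: derivative_eq_intros)
    moreover have "u * sin u \<ge> 0"
      using u assms by (intro mult_nonneg_nonneg sin_ge_zero) auto
    ultimately show "\<exists>d. ((\<lambda>u. sin u - u * cos u) has_real_derivative d) (at u) \<and> 0 \<le> d"
      by blast
  qed
  then show ?thesis by simp
qed

text \<open>With \<open>s\<close> and \<open>c\<close> at the half angle,
  \<open>x / 2 * c \<le> s\<close> gives \<open>x^2 * c^4 \<le> (sin x)^2\<close>, and
  \<open>cos x = 2 * c^2 - 1\<close> is at most \<open>c^4\<close>.\<close>

lemma square_mult_cos_le_sin_square: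
  fixes x :: real
  assumes "0 \<le> x" "x \<le> pi"
  shows "x\<^sup>2 * cos x \<le> (sin x)\<^sup>2"
proof -
  define s c where "s = sin (x / 2)" and "c = cos (x / 2)"
  have sin: "sin x = 2 * s * c" and cos: "cos x = 2 * c\<^sup>2 - 1"
    using sin_double[of "x / 2"] cos_double_cos[of "x / 2"] by (simp_all add: s_def c_def)
  have "0 \<le> c"
    unfolding c_def using assms by (intro cos_ge_zero) auto
  then have "(x / 2 * c)\<^sup>2 \<le> s\<^sup>2"
    using mult_cos_le_sin[of "x / 2"] assms by (intro power_mono) (auto simp: s_def c_def)
  then have "(x / 2 * c)\<^sup>2 * (4 * c\<^sup>2) \<le> s\<^sup>2 * (4 * c\<^sup>2)"
    by (rule mult_right_mono) simp
  moreover have "2 * c\<^sup>2 - 1 \<le> (c\<^sup>2)\<^sup>2"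
    using zero_le_power2[of "c\<^sup>2 - 1"] by (simp add: power2_diff)
  then have "x\<^sup>2 * (2 * c\<^sup>2 - 1) \<le> x\<^sup>2 * (c\<^sup>2)\<^sup>2"
    by (rule mult_left_mono) simp
  ultimately show ?thesis
    unfolding sin cos by (simp add: power2_eq_square algebra_simps)
qed

text \<open>After squaring and inserting the bound on \<open>w\<close>, the claim reduces to
  \<open>x^2 * (cos x + cos y) \<le> 2 * (sin x)^2\<close> times the positive factor
  \<open>cos x - cos y\<close>. This follows from the previous inequality since
  \<open>cos y < cos x\<close>.\<close>

lemma mult_sin_le_mult_sin:
  fixes x y w :: real
  assumes "0 < x" "x < y" "y \<le> pi" "0 \<le> w" and w: "x\<^sup>2 + 2 * cos x - 2 * cos y \<le> w\<^sup>2"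
  shows "x * sin y \<le> w * sin x"
proof (rule power2_le_imp_le)
  have less: "cos y < cos x"
    using assms by (intro cos_monotone_0_pi) auto
  have "x\<^sup>2 * (cos x + cos y) \<le> x\<^sup>2 * (2 * cos x)"
    using less by (intro mult_left_mono) auto
  also have "\<dots> \<le> 2 * (sin x)\<^sup>2"
    using square_mult_cos_le_sin_square[of x] assms by simp
  finally have "x\<^sup>2 * (cos x + cos y) * (cos x - cos y) \<le> 2 * (sin x)\<^sup>2 * (cos x - cos y)"
    using less by (intro mult_right_mono) auto
  then have "x\<^sup>2 * (1 - (cos y)\<^sup>2) \<le> x\<^sup>2 * (1 - (cos x)\<^sup>2) + (2 * cos x - 2 * cos y) * (sin x)\<^sup>2"
    by (simp add: algebra_simps power2_eq_square)
  then have "x\<^sup>2 * (sin y)\<^sup>2 \<le> (x\<^sup>2 + 2 * cos x - 2 * cos y) * (sin x)\<^sup>2"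
    by (simp add: sin_squared_eq algebra_simps)
  also have "\<dots> \<le> w\<^sup>2 * (sin x)\<^sup>2"
    by (intro mult_right_mono w) simp
  finally show "(x * sin y)\<^sup>2 \<le> (w * sin x)\<^sup>2"
    by (simp add: power_mult_distrib)
  show "0 \<le> w * sin x"
    using assms by (intro mult_nonneg_nonneg sin_ge_zero) auto
qed

section \<open>Transfer from a larger delay to the delay T\<close>

text \<open>At the delay \<open>T\<close> the real part is strictly decreasing with a zero
  \<open>r\<close> below \<open>w\<close>. The criterion with \<open>k = r\<close> thus only needs a
  positive imaginary part at \<open>r\<close>, which is deduced from the imaginary part at
  \<open>w\<close> for the delay \<tau>.\<close>

lemma stable_at_sqrt_delay:
  fixes a0 a1 a2 b0 \<tau> w :: real
  defines "T \<equiv> sqrt (2 * a2 / \<bar>b0\<bar>)"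
  assumes b0: "b0 < 0" "- a0 < b0" and a1: "a1 < 0" and a2: "a2 > 0"
    and \<tau>: "T < \<tau>" and w: "w > 0"
    and re: "re_on_imag_axis (char_fun a0 a1 a2 b0 0 0 \<tau>) w \<le> 0"
    and im: "\<And>\<omega>. 0 < \<omega> \<Longrightarrow> \<omega> < w \<Longrightarrow> im_on_imag_axis (char_fun a0 a1 a2 b0 0 0 \<tau>) \<omega> \<ge> 0"
  shows "stable (char_fun a0 a1 a2 b0 0 0 T)"
proof -
  have "2 * a2 / \<bar>b0\<bar> > 0"
    using b0 a2 by (intro divide_pos_pos) auto
  then have T: "T > 0" "T\<^sup>2 = 2 * a2 / \<bar>b0\<bar>"
    unfolding T_def by (rule real_sqrt_gt_zero, intro real_sqrt_pow2 less_imp_le)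
  have \<tau>0: "\<tau> > 0" using T \<tau> by simp
  have im_w: "im_on_imag_axis (char_fun a0 a1 a2 b0 0 0 \<tau>) \<omega> \<ge> 0" if "0 < \<omega>" "\<omega> \<le> w" for \<omega>
  proof (cases "\<omega> = w")
    case True
    let ?I = "im_on_imag_axis (char_fun a0 a1 a2 b0 0 0 \<tau>)"
    have "isCont ?I w"
      unfolding im_char_fun by (intro continuous_intros)
    then have "(?I \<longlongrightarrow> ?I w) (at_left w)"
      by (simp add: isCont_def filterlim_at_split)
    moreover have "eventually (\<lambda>\<omega>. 0 \<le> ?I \<omega>) (at_left w)"
      using im w by (intro eventually_at_leftI[of 0]) auto
    ultimately have "0 \<le> ?I w"
      by (rule tendsto_lowerbound) simp
    with True show ?thesis by simp
  qed (use im that in simp)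
  have sin_ge: "- a1 * \<omega> + \<omega> ^ 3 \<le> - b0 * sin (\<omega> * \<tau>)" if "0 < \<omega>" "\<omega> \<le> w" for \<omega>
    using im_w[OF that] by (simp add: im_char_fun)
  define y where "y = w * \<tau>"
  \<comment> \<open>Otherwise the frequency \<open>pi / \<tau>\<close> is admissible. There the sine
    vanishes, but the left side of \<open>sin_ge\<close> is positive.\<close>
  have y: "y < pi"
  proof (rule ccontr)
    assume "\<not> y < pi"
    then have "pi / \<tau> \<le> w" "pi / \<tau> > 0" using \<tau>0 by (simp_all add: y_def field_simps)
    from sin_ge[OF this(2,1)] have "- a1 * (pi / \<tau>) + (pi / \<tau>) ^ 3 \<le> 0"
      using \<tau>0 by simp
    moreover have "- a1 * (pi / \<tau>) + (pi / \<tau>) ^ 3 > 0"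
      using \<open>pi / \<tau> > 0\<close> a1 by (intro add_pos_pos mult_pos_pos zero_less_power) auto
    ultimately show False by linarith
  qed
  define f where "f u = u\<^sup>2 / 2 + cos u" for u :: real
  have f_less: "f u < f v" if "0 \<le> u" "u < v" for u v
    unfolding f_def using that by (rule half_square_plus_cos_less)
  have re_T: "re_on_imag_axis (char_fun a0 a1 a2 b0 0 0 T) \<omega> = a0 + b0 * f (\<omega> * T)" for \<omega>
    using b0 by (simp add: re_char_fun f_def power_mult_distrib T(2) field_simps)
  define xw where "xw = w * T"
  have xw: "0 < xw" "xw < y"
    using w T \<tau> by (simp_all add: xw_def y_def)
  \<comment> \<open>The value of \<open>T\<close> rewrites \<open>a2 * w^2\<close> in terms of
    \<open>xw\<close>, so \<tau> remains in the hypothesis on the real part only through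
    \<open>cos y\<close>.\<close>
  have "- b0 * (xw\<^sup>2 / 2) = a2 * w\<^sup>2"
    using b0 by (simp add: xw_def power_mult_distrib T(2) field_simps)
  then have re': "a0 \<le> - b0 * (xw\<^sup>2 / 2 + cos y)"
    using re by (simp add: re_char_fun y_def algebra_simps)
  \<comment> \<open>Lowering the angle from \<open>y\<close> to \<open>xw\<close> raises the cosine,
    so the real part at \<open>w\<close> becomes strictly negative for the delay
    \<open>T\<close>.\<close>
  have "cos y < cos xw"
    using xw y by (intro cos_monotone_0_pi) auto
  then have "- b0 * (xw\<^sup>2 / 2 + cos y) < - b0 * f xw"
    using b0 unfolding f_def by (intro mult_strict_left_mono) auto
  with re' have f_xw: "a0 < - b0 * f xw" by linarith
  \<comment> \<open>At 0 the left side is \<open>- b0 < a0\<close>, and at \<open>xw\<close> it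
    exceeds \<open>a0\<close>. The solution corresponds to the zero \<open>r = x / T\<close> of the
    real part.\<close>
  have "\<exists>x\<ge>0. x \<le> xw \<and> - b0 * f x = a0"
    using xw b0 f_xw unfolding f_def
    by (intro IVT'[of "\<lambda>u. - b0 * (u\<^sup>2 / 2 + cos u)"] continuous_intros) auto
  then obtain x where x: "0 \<le> x" "x \<le> xw" "- b0 * f x = a0" by blast
  have "x \<noteq> xw" "x \<noteq> 0"
    using f_xw x b0 by (auto simp: f_def)
  with x have x': "0 < x" "x < xw" by auto
  define r where "r = x / T"
  have r: "0 < r" "r < w" "x = r * T"
    using x' T by (simp_all add: r_def xw_def field_simps)
  have "- b0 * f x \<le> - b0 * (xw\<^sup>2 / 2 + cos y)"
    using re' x by simp
  then have "f x \<le> xw\<^sup>2 / 2 + cos y"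
    using b0 by simp
  then have "x * sin y \<le> xw * sin x"
    using x' xw y by (intro mult_sin_le_mult_sin) (auto simp: f_def)
  then have "T * (r * sin y) \<le> T * (w * sin x)"
    by (simp add: r(3) xw_def mult_ac)
  then have "r * sin y \<le> w * sin x"
    using T by simp
  then have "- b0 * (r * sin y) \<le> - b0 * (w * sin x)"
    using b0 by (intro mult_left_mono) auto
  moreover have "r * (- a1 * w + w ^ 3) \<le> r * (- b0 * sin y)"
    using sin_ge[of w] w r unfolding y_def by (intro mult_left_mono) auto
  \<comment> \<open>The sine comparison, scaled by \<open>- b0\<close>, is chained with
    \<open>sin_ge\<close> at \<open>w\<close>. After cancelling \<open>w\<close>, replacing
    \<open>w^2\<close> by the smaller \<open>r^2\<close> makes the inequality strict.\<close>
  ultimately have "w * (r * (- a1 + w\<^sup>2)) \<le> w * (- b0 * sin x)"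
    by (simp add: algebra_simps power2_eq_square power3_eq_cube)
  then have "r * (- a1 + w\<^sup>2) \<le> - b0 * sin x"
    using w by (rule mult_left_le_imp_le)
  moreover have "r\<^sup>2 < w\<^sup>2"
    using r by (intro power_strict_mono) auto
  then have "r * (- a1 + r\<^sup>2) < r * (- a1 + w\<^sup>2)"
    using r by simp
  ultimately have im_r: "im_on_imag_axis (char_fun a0 a1 a2 b0 0 0 T) r > 0"
    unfolding im_char_fun r(3) by (simp add: algebra_simps power2_eq_square power3_eq_cube)
  show ?thesis
  proof (rule stable_char_fun_criterion[of T r])
    fix \<omega> :: real assume \<omega>: "\<omega> \<ge> 0"
    consider "\<omega> < r" | "\<omega> = r" | "\<omega> > r" by linarith
    then show "re_on_imag_axis (char_fun a0 a1 a2 b0 0 0 T) \<omega> > 0 \<and> \<omega> < r \<or>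
      im_on_imag_axis (char_fun a0 a1 a2 b0 0 0 T) \<omega> > 0 \<and> 0 < \<omega> \<and> \<omega> < 3 * r \<or>
      re_on_imag_axis (char_fun a0 a1 a2 b0 0 0 T) \<omega> < 0 \<and> \<omega> > r"
    proof cases
      case 1
      then have "f (\<omega> * T) < f x"
        using \<omega> T unfolding r(3) by (intro f_less) auto
      then have "- b0 * f (\<omega> * T) < - b0 * f x"
        using b0 by (intro mult_strict_left_mono) auto
      with 1 x(3) show ?thesis unfolding re_T by simp
    next
      case 2
      with im_r r show ?thesis by simp
    next
      case 3
      then have "f x < f (\<omega> * T)"
        using r T unfolding r(3) by (intro f_less) auto
      then have "- b0 * f x < - b0 * f (\<omega> * T)"
        using b0 by (intro mult_strict_left_mono) auto
      with 3 x(3) show ?thesis unfolding re_T by simp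
    qed
  qed (use T r in auto)
qed

section \<open>A stable delay up to T for small perturbations\<close>

text \<open>The bound on \<open>b1\<close>, \<open>b2\<close> must be uniform in \<open>w\<close>,
  which is obtained by compactness: counterexamples with \<open>b1\<close>, \<open>b2\<close>
  tending to 0 have frequencies with a convergent subsequence, and the limit is
  contradictory.\<close>

lemma exists_stable_delay:
  fixes a0 a1 a2 b0 \<tau> :: real
  defines "T \<equiv> sqrt (2 * a2 / \<bar>b0\<bar>)"
  assumes b0: "b0 < 0" "- a0 < b0" and a1: "a1 < 0" and a2: "a2 > 0" and \<tau>: "\<tau> \<ge> 0"
  shows "\<exists>\<delta>>0. \<forall>b1 b2 w. \<bar>b1\<bar> < \<delta> \<longrightarrow> \<bar>b2\<bar> < \<delta> \<longrightarrow> w > 0 \<longrightarrow>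
           re_on_imag_axis (char_fun a0 a1 a2 b0 b1 b2 \<tau>) w < 0 \<longrightarrow>
           (\<forall>\<omega>\<in>{0<..<w}. im_on_imag_axis (char_fun a0 a1 a2 b0 b1 b2 \<tau>) \<omega> > 0) \<longrightarrow>
           (\<exists>\<sigma>\<in>{0..T}. stable (char_fun a0 a1 a2 b0 b1 b2 \<sigma>))"
proof (rule ccontr)
  assume neg: "\<not> ?thesis"
  have "2 * a2 / \<bar>b0\<bar> > 0"
    using b0 a2 by (intro divide_pos_pos) auto
  then have T: "T > 0" "T\<^sup>2 = 2 * a2 / \<bar>b0\<bar>"
    unfolding T_def by (rule real_sqrt_gt_zero, intro real_sqrt_pow2 less_imp_le)
  define R where "R b1 b2 = re_on_imag_axis (char_fun a0 a1 a2 b0 b1 b2 \<tau>)" for b1 b2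
  define I where "I b1 b2 = im_on_imag_axis (char_fun a0 a1 a2 b0 b1 b2 \<tau>)" for b1 b2
  \<comment> \<open>The factor \<open>min 1 (a2 / 4)\<close> keeps the perturbed terms below the
    leading ones for every \<open>n\<close>, so that the frequency bounds \<open>M\<close> below do
    not depend on \<open>n\<close>.\<close>
  define e where "e n = min 1 (a2 / 4) * inverse (real (Suc n))" for n
  have e: "e n > 0" "e n \<le> 1" "e n \<le> a2 / 4" for n
  proof -
    have i: "0 < inverse (real (Suc n))" "inverse (real (Suc n)) \<le> 1"
      by (simp_all add: inverse_le_1_iff)
    with a2 show "e n > 0" by (simp add: e_def)
    have "e n \<le> min 1 (a2 / 4)"
      unfolding e_def using a2 i by (intro mult_left_le) auto
    then show "e n \<le> 1" "e n \<le> a2 / 4" by auto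
  qed
  have e_lim: "e \<longlonglongrightarrow> 0"
    unfolding e_def using tendsto_mult_right_zero[OF LIMSEQ_inverse_real_of_nat] by simp
  define bad where "bad n b1 b2 w \<longleftrightarrow> \<bar>b1\<bar> < e n \<and> \<bar>b2\<bar> < e n \<and> w > 0 \<and> R b1 b2 w < 0 \<and>
      (\<forall>\<omega>\<in>{0<..<w}. I b1 b2 \<omega> > 0) \<and> (\<forall>\<sigma>\<in>{0..T}. \<not> stable (char_fun a0 a1 a2 b0 b1 b2 \<sigma>))"
    for n b1 b2 w
  have "\<exists>b1 b2 w. bad n b1 b2 w" for n
  proof (rule ccontr)
    assume none: "\<not> ?thesis"
    show False
      by (rule notE[OF neg], rule exI[of _ "e n"])
        (use none e(1)[of n] in \<open>unfold bad_def R_def I_def, blast\<close>)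
  qed
  then obtain \<beta>1 \<beta>2 w where "\<And>n. bad n (\<beta>1 n) (\<beta>2 n) (w n)"
    by metis
  then have \<beta>: "\<And>n. \<bar>\<beta>1 n\<bar> < e n" "\<And>n. \<bar>\<beta>2 n\<bar> < e n" and w: "\<And>n. w n > 0"
    and Rneg: "\<And>n. R (\<beta>1 n) (\<beta>2 n) (w n) < 0"
    and Ipos: "\<And>n \<omega>. 0 < \<omega> \<Longrightarrow> \<omega> < w n \<Longrightarrow> I (\<beta>1 n) (\<beta>2 n) \<omega> > 0"
    and nst: "\<And>n \<sigma>. 0 \<le> \<sigma> \<Longrightarrow> \<sigma> \<le> T \<Longrightarrow> \<not> stable (char_fun a0 a1 a2 b0 (\<beta>1 n) (\<beta>2 n) \<sigma>)"
    unfolding bad_def by auto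
  have lim: "\<beta>1 \<longlonglongrightarrow> 0" "\<beta>2 \<longlonglongrightarrow> 0"
    using \<beta> e_lim by (auto intro!: Lim_null_comparison[of _ e] always_eventually less_imp_le)
  have R0: "R 0 0 0 > 0"
    using b0 by (simp add: R_def re_char_fun)
  have R_lim: "(\<lambda>n. R (\<beta>1 (\<rho> n)) (\<beta>2 (\<rho> n)) (u n)) \<longlonglongrightarrow> R 0 0 l"
    if "u \<longlonglongrightarrow> l" "strict_mono \<rho>" for u l \<rho>
  proof -
    have "(\<lambda>n. \<beta>1 (\<rho> n)) \<longlonglongrightarrow> 0" "(\<lambda>n. \<beta>2 (\<rho> n)) \<longlonglongrightarrow> 0"
      using LIMSEQ_subseq_LIMSEQ[OF lim(1) that(2)] LIMSEQ_subseq_LIMSEQ[OF lim(2) that(2)]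
      by (simp_all add: o_def)
    then show ?thesis
      unfolding R_def re_char_fun using that(1) by (intro tendsto_intros)
  qed
  have bound: "p * q \<le> \<bar>p\<bar>" if "\<bar>q\<bar> \<le> 1" for p q :: real
    using mult_left_le[OF that abs_ge_zero[of p]] abs_ge_self[of "p * q"]
    by (simp add: abs_mult)
  show False
  proof (cases "\<tau> \<le> T")
    case True
    define D where "D b1 b2 \<omega> = - 2 * a2 * \<omega> - 2 * b2 * \<omega> * cos (\<omega> * \<tau>)
      - (b0 - b2 * \<omega>\<^sup>2) * \<tau> * sin (\<omega> * \<tau>) + b1 * sin (\<omega> * \<tau>) + b1 * \<omega> * \<tau> * cos (\<omega> * \<tau>)" for b1 b2 \<omega>
    have D: "(R b1 b2 has_real_derivative D b1 b2 \<omega>) (at \<omega>)" for b1 b2 \<omega>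
      unfolding R_def re_char_fun[abs_def] D_def
      by (auto intro!: derivative_eq_intros simp: algebra_simps)
    define M where "M = 1 + 2 * (a0 + \<bar>b0\<bar>) / a2"
    have far: "R (\<beta>1 n) (\<beta>2 n) \<omega> < 0" if "\<omega> > M" for n \<omega>
    proof -
      have \<omega>1: "\<omega> > 1" and \<omega>2: "\<omega> > 2 * (a0 + \<bar>b0\<bar>) / a2"
        using that b0 a2 unfolding M_def by (smt (verit) divide_nonneg_pos)+
      have sq: "\<omega> \<le> \<omega>\<^sup>2" using \<omega>1 by (simp add: self_le_power)
      have "R (\<beta>1 n) (\<beta>2 n) \<omega> \<le> a0 - a2 * \<omega>\<^sup>2 + \<bar>b0 - \<beta>2 n * \<omega>\<^sup>2\<bar> + \<bar>\<beta>1 n * \<omega>\<bar>"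
        unfolding R_def re_char_fun by (intro add_mono bound order_refl) simp_all
      also have "\<bar>b0 - \<beta>2 n * \<omega>\<^sup>2\<bar> \<le> \<bar>b0\<bar> + \<bar>\<beta>2 n\<bar> * \<omega>\<^sup>2"
        using abs_triangle_ineq4[of b0 "\<beta>2 n * \<omega>\<^sup>2"] by (simp add: abs_mult)
      also have "\<bar>\<beta>2 n\<bar> * \<omega>\<^sup>2 \<le> a2 / 4 * \<omega>\<^sup>2"
        using \<beta>(2)[of n] e(3)[of n] by (intro mult_right_mono) auto
      also have "\<bar>\<beta>1 n * \<omega>\<bar> \<le> a2 / 4 * \<omega>\<^sup>2"
        unfolding abs_mult using \<beta>(1)[of n] e(3)[of n] sq \<omega>1 a2 by (intro mult_mono) auto
      finally have "R (\<beta>1 n) (\<beta>2 n) \<omega> \<le> a0 + \<bar>b0\<bar> - a2 / 2 * \<omega>\<^sup>2"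
        by simp
      also have "a2 * \<omega>\<^sup>2 > 2 * (a0 + \<bar>b0\<bar>)"
        using \<omega>2 sq a2 by (smt (verit) mult.commute pos_divide_less_eq)
      then have "a0 + \<bar>b0\<bar> - a2 / 2 * \<omega>\<^sup>2 < 0" by simp
      finally show ?thesis .
    qed
    have "\<exists>\<xi>>w n. \<xi> \<le> M \<and> D (\<beta>1 n) (\<beta>2 n) \<xi> \<ge> 0" for n
    proof -
      \<comment> \<open>If the real part stayed negative from \<open>w n\<close> on, the criterion
        with \<open>k = w n / 2\<close> would make \<tau> itself stable; its middle range then
        reaches beyond \<open>w n\<close>. A return to nonnegative values yields a point with
        positive derivative.\<close>
      have "\<exists>\<omega>\<ge>w n. R (\<beta>1 n) (\<beta>2 n) \<omega> \<ge> 0"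
      proof (rule ccontr)
        assume "\<not> ?thesis"
        then have Rn: "R (\<beta>1 n) (\<beta>2 n) \<omega> < 0" if "\<omega> \<ge> w n" for \<omega>
          using that by (meson not_less)
        have "stable (char_fun a0 a1 a2 b0 (\<beta>1 n) (\<beta>2 n) \<tau>)"
        proof (rule stable_char_fun_criterion[OF \<tau>, of "w n / 2"])
          fix \<omega> :: real assume "\<omega> \<ge> 0"
          then consider "\<omega> = 0" | "0 < \<omega>" "\<omega> < w n" | "w n \<le> \<omega>" by linarith
          then show "re_on_imag_axis (char_fun a0 a1 a2 b0 (\<beta>1 n) (\<beta>2 n) \<tau>) \<omega> > 0 \<and> \<omega> < w n / 2 \<or>
            im_on_imag_axis (char_fun a0 a1 a2 b0 (\<beta>1 n) (\<beta>2 n) \<tau>) \<omega> > 0 \<and> 0 < \<omega> \<and> \<omega> < 3 * (w n / 2) \<or>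
            re_on_imag_axis (char_fun a0 a1 a2 b0 (\<beta>1 n) (\<beta>2 n) \<tau>) \<omega> < 0 \<and> \<omega> > w n / 2"
          proof cases
            case 1
            with b0 w[of n] show ?thesis by (simp add: re_char_fun)
          next
            case 2
            with Ipos[of \<omega> n] show ?thesis by (simp add: I_def)
          next
            case 3
            with Rn[of \<omega>] w[of n] show ?thesis by (simp add: R_def)
          qed
        qed (use w[of n] in simp)
        with nst \<tau> True show False by blast
      qed
      then obtain \<omega> where \<omega>: "w n \<le> \<omega>" "R (\<beta>1 n) (\<beta>2 n) \<omega> \<ge> 0" by blast
      with Rneg[of n] have less: "w n < \<omega>" by (metis leD order_le_less)
      have "\<omega> \<le> M" using far[of \<omega> n] \<omega>(2) by linarith
      obtain \<xi> where \<xi>: "w n < \<xi>" "\<xi> < \<omega>"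
        "R (\<beta>1 n) (\<beta>2 n) \<omega> - R (\<beta>1 n) (\<beta>2 n) (w n) = (\<omega> - w n) * D (\<beta>1 n) (\<beta>2 n) \<xi>"
        using MVT2[OF less, of "R (\<beta>1 n) (\<beta>2 n)" "D (\<beta>1 n) (\<beta>2 n)"] D by blast
      then have "(\<omega> - w n) * D (\<beta>1 n) (\<beta>2 n) \<xi> > 0"
        using \<omega>(2) Rneg[of n] by linarith
      then have "D (\<beta>1 n) (\<beta>2 n) \<xi> > 0"
        using less by (simp add: zero_less_mult_iff)
      with \<xi> \<open>\<omega> \<le> M\<close> show ?thesis by (intro exI[of _ \<xi>]) auto
    qed
    then obtain \<xi> where \<xi>: "\<And>n. w n < \<xi> n" "\<And>n. \<xi> n \<le> M" "\<And>n. D (\<beta>1 n) (\<beta>2 n) (\<xi> n) \<ge> 0"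
      by metis
    have "\<xi> n \<in> {0..M}" for n using \<xi>(1,2)[of n] w[of n] by simp
    then obtain l \<rho> where l: "l \<in> {0..M}" "strict_mono \<rho>" "(\<xi> \<circ> \<rho>) \<longlonglongrightarrow> l"
      using compact_Icc[of 0 M] unfolding compact_def by metis
    have \<xi>_lim: "(\<lambda>n. \<xi> (\<rho> n)) \<longlonglongrightarrow> l" using l(3) by (simp add: o_def)
    have "(\<lambda>n. \<beta>1 (\<rho> n)) \<longlonglongrightarrow> 0" "(\<lambda>n. \<beta>2 (\<rho> n)) \<longlonglongrightarrow> 0"
      using LIMSEQ_subseq_LIMSEQ[OF lim(1) l(2)] LIMSEQ_subseq_LIMSEQ[OF lim(2) l(2)]
      by (simp_all add: o_def)
    then have "(\<lambda>n. D (\<beta>1 (\<rho> n)) (\<beta>2 (\<rho> n)) (\<xi> (\<rho> n))) \<longlonglongrightarrow> D 0 0 l"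
      unfolding D_def using \<xi>_lim by (intro tendsto_intros)
    then have D_nonneg: "D 0 0 l \<ge> 0"
      by (rule LIMSEQ_le_const) (use \<xi>(3) in blast)
    \<comment> \<open>For \<open>b1 = b2 = 0\<close> the derivative is negative at positive
      frequencies, by \<open>sin u < u\<close> and
      \<open>\<tau>^2 \<le> T^2 = 2 * a2 / \<bar>b0\<bar>\<close>.\<close>
    have "l = 0"
    proof (rule ccontr)
      assume "l \<noteq> 0"
      then have "l > 0" using l(1) by simp
      have "- b0 * \<tau> * sin (l * \<tau>) < 2 * a2 * l"
      proof (cases "\<tau> = 0")
        case True
        with a2 \<open>l > 0\<close> show ?thesis by simp
      next
        case False
        then have "\<tau> > 0" using \<tau> by simp
        then have "- b0 * \<tau> * sin (l * \<tau>) < - b0 * \<tau> * (l * \<tau>)"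
          using b0 \<open>l > 0\<close> by (intro mult_strict_left_mono sin_less_self mult_pos_pos) auto
        also have "\<dots> = - b0 * l * \<tau>\<^sup>2" by (simp add: power2_eq_square)
        also have "\<dots> \<le> - b0 * l * T\<^sup>2"
          using True \<tau> b0 \<open>l > 0\<close> by (intro mult_left_mono power_mono mult_nonneg_nonneg) auto
        also have "\<dots> = 2 * a2 * l" using b0 by (simp add: T(2))
        finally show ?thesis .
      qed
      with D_nonneg show False by (simp add: D_def)
    qed
    \<comment> \<open>Since \<open>w n < \<xi> n\<close>, the frequencies tend to 0 as well. There
      the limiting real part is \<open>a0 + b0 > 0\<close>, against \<open>Rneg\<close>.\<close>
    have "(\<lambda>n. w (\<rho> n)) \<longlonglongrightarrow> 0"
    proof (rule Lim_null_comparison[of _ "\<lambda>n. \<xi> (\<rho> n)"])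
      show "(\<lambda>n. \<xi> (\<rho> n)) \<longlonglongrightarrow> 0" using \<xi>_lim \<open>l = 0\<close> by simp
      show "eventually (\<lambda>n. norm (w (\<rho> n)) \<le> \<xi> (\<rho> n)) sequentially"
        using \<xi>(1) w by (intro always_eventually) (auto simp: less_imp_le)
    qed
    from R_lim[OF this l(2)] have "R 0 0 0 \<le> 0"
      by (rule LIMSEQ_le_const2) (use Rneg in \<open>auto intro: less_imp_le\<close>)
    with R0 show False by simp
  next
    case False
    \<comment> \<open>At this frequency the cubic term is \<open>(3 + \<bar>b0\<bar>) * M^2\<close>,
      while the other terms contribute at most \<open>(2 + \<bar>b0\<bar>) * M^2\<close>. The
      imaginary part is negative there, so no \<open>w n\<close> exceeds \<open>M\<close>.\<close>
    define M where "M = 3 + \<bar>b0\<bar>"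
    have "w n \<le> M" for n
    proof (rule ccontr)
      assume "\<not> ?thesis"
      then have pos: "I (\<beta>1 n) (\<beta>2 n) M > 0"
        by (intro Ipos) (auto simp: M_def)
      have b: "\<bar>\<beta>1 n\<bar> \<le> 1" "\<bar>\<beta>2 n\<bar> \<le> 1"
        using \<beta>[of n] e(2)[of n] by auto
      have M1: "M \<ge> 3" by (simp add: M_def)
      have "I (\<beta>1 n) (\<beta>2 n) M = a1 * M - M ^ 3 + (b0 - \<beta>2 n * M\<^sup>2) * (- sin (M * \<tau>))
          + \<beta>1 n * M * cos (M * \<tau>)"
        by (simp add: I_def im_char_fun)
      also have "\<dots> \<le> 0 - M ^ 3 + \<bar>b0 - \<beta>2 n * M\<^sup>2\<bar> + \<bar>\<beta>1 n * M\<bar>"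
        using a1 M1 by (intro add_mono diff_mono bound order_refl) (simp_all add: mult_nonpos_nonneg)
      also have "\<bar>b0 - \<beta>2 n * M\<^sup>2\<bar> \<le> \<bar>b0\<bar> + \<bar>\<beta>2 n\<bar> * M\<^sup>2"
        using abs_triangle_ineq4[of b0 "\<beta>2 n * M\<^sup>2"] by (simp add: abs_mult)
      also have "\<bar>\<beta>2 n\<bar> * M\<^sup>2 \<le> 1 * M\<^sup>2"
        using b by (intro mult_right_mono) auto
      also have "\<bar>\<beta>1 n * M\<bar> \<le> 1 * M\<^sup>2"
        unfolding abs_mult using b M1 by (intro mult_mono) (auto simp: self_le_power)
      also have "\<bar>b0\<bar> \<le> \<bar>b0\<bar> * M\<^sup>2"
        using M1 by (simp add: mult_le_cancel_left1 one_le_power)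
      also have "0 - M ^ 3 + (\<bar>b0\<bar> * M\<^sup>2 + 1 * M\<^sup>2) + 1 * M\<^sup>2 = - (M\<^sup>2)"
        by (simp add: M_def power3_eq_cube power2_eq_square algebra_simps)
      finally have "I (\<beta>1 n) (\<beta>2 n) M \<le> - (M\<^sup>2)" by simp
      with pos show False
        using zero_le_power2[of M] by linarith
    qed
    then have "w n \<in> {0..M}" for n using w[of n] by simp
    then obtain l \<rho> where l: "l \<in> {0..M}" "strict_mono \<rho>" "(w \<circ> \<rho>) \<longlonglongrightarrow> l"
      using compact_Icc[of 0 M] unfolding compact_def by metis
    have w_lim: "(\<lambda>n. w (\<rho> n)) \<longlonglongrightarrow> l" using l(3) by (simp add: o_def)
    have Rl: "R 0 0 l \<le> 0"
      by (rule LIMSEQ_le_const2[OF R_lim[OF w_lim l(2)]]) (use Rneg in \<open>auto intro: less_imp_le\<close>)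
    with R0 l(1) have "l > 0" by (cases "l = 0") auto
    have Il: "I 0 0 \<omega> \<ge> 0" if "0 < \<omega>" "\<omega> < l" for \<omega>
    proof -
      have "(\<lambda>n. \<beta>1 (\<rho> n)) \<longlonglongrightarrow> 0" "(\<lambda>n. \<beta>2 (\<rho> n)) \<longlonglongrightarrow> 0"
        using LIMSEQ_subseq_LIMSEQ[OF lim(1) l(2)] LIMSEQ_subseq_LIMSEQ[OF lim(2) l(2)]
        by (simp_all add: o_def)
      then have "(\<lambda>n. I (\<beta>1 (\<rho> n)) (\<beta>2 (\<rho> n)) \<omega>) \<longlonglongrightarrow> I 0 0 \<omega>"
        unfolding I_def im_char_fun by (intro tendsto_intros)
      moreover have "eventually (\<lambda>n. \<omega> < w (\<rho> n)) sequentially"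
        using order_tendstoD(1)[OF w_lim that(2)] .
      then have "eventually (\<lambda>n. 0 \<le> I (\<beta>1 (\<rho> n)) (\<beta>2 (\<rho> n)) \<omega>) sequentially"
        by eventually_elim (use Ipos that in \<open>auto intro: less_imp_le\<close>)
      ultimately show ?thesis
        by (rule tendsto_lowerbound) simp
    qed
    have st: "stable (char_fun a0 a1 a2 b0 0 0 T)"
      unfolding T_def using False b0 a1 a2 \<open>l > 0\<close> Rl Il
      by (intro stable_at_sqrt_delay[of b0 a0 a1 a2 \<tau> l]) (auto simp: T_def R_def I_def)
    \<comment> \<open>The parameter is the pair of \<open>b1\<close> and \<open>b2\<close>, with the
      delay fixed at \<open>T\<close>. Non-stability along the sequence would pass to the limit (0,
      0).\<close>
    interpret char_family "{-1..1::real} \<times> {-1..1::real}" "\<lambda>_. a0" "\<lambda>_. a1" "\<lambda>_. a2"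
      "\<lambda>_. b0" fst snd "\<lambda>_. T"
      using T by unfold_locales (auto intro!: compact_Times continuous_intros)
    have "(\<beta>1 n, \<beta>2 n) \<in> {p \<in> {-1..1} \<times> {-1..1}. \<not> stable (F p)}" for n
      using \<beta>[of n] e(2)[of n] nst[of T n] T by (auto simp: abs_less_iff)
    from closed_sequentially[OF closed_not_stable this tendsto_Pair[OF lim]]
    show False using st by simp
  qed
qed

section \<open>Instability at delay zero and the stable delay combined\<close>

theorem mainTheorem1:
  fixes a0 a1 a2 b0 \<tau>bar :: real
  assumes "0 > b0" and "b0 > - a0" and "0 > a1"
    and "a2 > a1\<^sup>2 / (2 * \<bar>b0\<bar>)" and "\<tau>bar \<ge> 0"
  shows "\<exists>\<delta>>0. \<forall>b1 b2 :: real. \<bar>b1\<bar> < \<delta> \<longrightarrow> \<bar>b2\<bar> < \<delta> \<longrightarrow>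
           (\<exists>\<omega>bar>0. re_on_imag_axis (char_fun a0 a1 a2 b0 b1 b2 \<tau>bar) \<omega>bar < 0 \<and>
              (\<forall>\<omega>\<in>{0<..<\<omega>bar}. im_on_imag_axis (char_fun a0 a1 a2 b0 b1 b2 \<tau>bar) \<omega> > 0)) \<longrightarrow>
           (\<exists>\<tau>10. stability_gain (char_fun a0 a1 a2 b0 b1 b2) \<tau>10 \<and>
              \<tau>10 \<le> sqrt (2 * a2 / \<bar>b0\<bar>))"
proof -
  have "a1\<^sup>2 / (2 * \<bar>b0\<bar>) \<ge> 0" by simp
  then have a2: "a2 > 0" using assms(4) by linarith
  obtain \<delta> where \<delta>: "\<delta> > 0" and st: "\<And>b1 b2 w. \<lbrakk>\<bar>b1\<bar> < \<delta>; \<bar>b2\<bar> < \<delta>; w > 0;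
      re_on_imag_axis (char_fun a0 a1 a2 b0 b1 b2 \<tau>bar) w < 0;
      \<forall>\<omega>\<in>{0<..<w}. im_on_imag_axis (char_fun a0 a1 a2 b0 b1 b2 \<tau>bar) \<omega> > 0\<rbrakk>
      \<Longrightarrow> \<exists>\<sigma>\<in>{0..sqrt (2 * a2 / \<bar>b0\<bar>)}. stable (char_fun a0 a1 a2 b0 b1 b2 \<sigma>)"
    using exists_stable_delay[OF assms(1,2,3) a2 assms(5)] by (elim exE conjE) blast
  show ?thesis
  \<comment> \<open>The bound \<open>- a1\<close> keeps \<open>a1 + b1\<close> negative, as the
    instability at delay 0 requires.\<close>
  proof (rule exI[of _ "min \<delta> (- a1)"], intro conjI allI impI)
    show "min \<delta> (- a1) > 0" using \<delta> assms by simp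
    fix b1 b2 :: real
    assume b: "\<bar>b1\<bar> < min \<delta> (- a1)" "\<bar>b2\<bar> < min \<delta> (- a1)"
      and "\<exists>\<omega>bar>0. re_on_imag_axis (char_fun a0 a1 a2 b0 b1 b2 \<tau>bar) \<omega>bar < 0 \<and>
        (\<forall>\<omega>\<in>{0<..<\<omega>bar}. im_on_imag_axis (char_fun a0 a1 a2 b0 b1 b2 \<tau>bar) \<omega> > 0)"
    then obtain w where "w > 0" "re_on_imag_axis (char_fun a0 a1 a2 b0 b1 b2 \<tau>bar) w < 0"
        "\<forall>\<omega>\<in>{0<..<w}. im_on_imag_axis (char_fun a0 a1 a2 b0 b1 b2 \<tau>bar) \<omega> > 0"
      by blast
    from st[OF _ _ this] b obtain \<sigma> where \<sigma>: "0 \<le> \<sigma>" "\<sigma> \<le> sqrt (2 * a2 / \<bar>b0\<bar>)"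
        "stable (char_fun a0 a1 a2 b0 b1 b2 \<sigma>)"
      by auto
    have "a0 + b0 > 0" "a1 + b1 < 0" using assms b by linarith+
    then obtain z :: complex where "Re z > 0"
      "z ^ 3 + of_real (a2 + b2) * z\<^sup>2 + of_real (a1 + b1) * z + of_real (a0 + b0) = 0"
      using real_cubic_root_right_half_plane by blast
    then have "unstable (char_fun a0 a1 a2 b0 b1 b2 0)"
      unfolding unstable_def char_fun_def
      by (intro exI[of _ z]) (simp add: algebra_simps)
    from stability_gain_if_stable[OF this \<sigma>(3,1)] \<sigma>(2)
    show "\<exists>\<tau>10. stability_gain (char_fun a0 a1 a2 b0 b1 b2) \<tau>10 \<and> \<tau>10 \<le> sqrt (2 * a2 / \<bar>b0\<bar>)"
      by (meson order_trans)
  qed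
qed

end
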